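(* Let $(M,\Delta,g_c)$ be a sub-Riemannian manifold with $\Delta$ of rank $k$, and let $\widetilde\Delta$ be a fixed smooth distribution complementary to $\Delta$ in $TM$. Then the horizontal connection $\widetilde D:\Gamma(\Delta)\times\Gamma(\Delta)\to\Gamma(\Delta)$, $\widetilde D_XY=\sum_{i=1}^kg(\nabla_XY,X_i)X_i$, is independent of the choice of the orthogonal extension $g$ of $g_c$; that is, any two orthogonal extensions of $g_c$ (for which $\Delta$ and $\widetilde\Delta$ are orthogonal) define the same operator $\widetilde D$.
   Context: A sub-Riemannian manifold $(M,\Delta,g_c)$ is a smooth manifold $M$ of dimension $m$ with a smooth distribution (subbundle of $TM$) $\Delta$ of rank $k<m$ endowed with a smooth fiberwise inner product $g_c$. $\Gamma(\Delta)$ denotes the smooth sections of $\Delta$. An orthogonal extension of $g_c$ is a Riemannian metric $g$ on $M$ whose restriction to $\Delta$ is $g_c$ and for which $TM=\Delta\oplus\widetilde\Delta$ is a $g$-orthogonal decomposition. $\nabla$ is the Levi-Civita connection of $g$, and $\{X_1,\dots,X_k\}$ is any local $g_c$-orthonormal basis of $\Delta$ (the definition of $\widetilde D$ does not depend on this basis). *)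

theory Defs
  imports "HOL-Analysis.Analysis" "HOL-Library.Function_Algebras"
begin

section \<open>Real-valued functions with pointwise operations as a real vector space\<close>

instantiation "fun" :: (type, real_vector) real_vector
begin

definition scaleR_fun :: "real \<Rightarrow> ('a \<Rightarrow> 'b) \<Rightarrow> 'a \<Rightarrow> 'b"
  where "scaleR_fun c f = (\<lambda>x. c *\<^sub>R f x)"

instance
  by standard (simp_all add: scaleR_fun_def fun_eq_iff algebra_simps)

end

section \<open>Smooth manifolds\<close>

text \<open>The sets \<open>S\<close> below are always open, so differentiability at a point of \<open>S\<close> does not
  depend on the values outside \<open>S\<close>.\<close>

primrec Ck_on ::
  "nat \<Rightarrow> ('e::euclidean_space \<Rightarrow> 'f::real_normed_vector) \<Rightarrow> 'e set \<Rightarrow> bool" where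
  "Ck_on 0 f S \<longleftrightarrow> continuous_on S f"
| "Ck_on (Suc n) f S \<longleftrightarrow>
     (\<forall>x\<in>S. f differentiable (at x)) \<and>
     (\<forall>v. Ck_on n (\<lambda>x. frechet_derivative f (at x) v) S)"

definition smooth_on ::
  "('e::euclidean_space \<Rightarrow> 'f::real_normed_vector) \<Rightarrow> 'e set \<Rightarrow> bool"
  where "smooth_on f S \<longleftrightarrow> (\<forall>n. Ck_on n f S)"

type_synonym ('a, 'e) chart = "'a set \<times> ('a \<Rightarrow> 'e)"

text \<open>A manifold of dimension \<open>DIM('e)\<close> is a Hausdorff second countable type \<open>'a\<close> with a
  smooth atlas; the atlas need not be maximal.\<close>

definition smooth_atlas ::
  "('a::{t2_space, second_countable_topology}, 'e::euclidean_space) chart set \<Rightarrow> bool" where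
  "smooth_atlas A \<longleftrightarrow>
     (\<forall>(U, \<phi>)\<in>A. open U \<and> open (\<phi> ` U) \<and> homeomorphism U (\<phi> ` U) \<phi> (inv_into U \<phi>)) \<and>
     (\<Union>(U, \<phi>)\<in>A. U) = UNIV \<and>
     (\<forall>(U, \<phi>)\<in>A. \<forall>(V, \<psi>)\<in>A. smooth_on (\<psi> \<circ> inv_into U \<phi>) (\<phi> ` (U \<inter> V)))"

definition smooth_fun_on ::
  "('a::{t2_space, second_countable_topology}, 'e::euclidean_space) chart set
     \<Rightarrow> 'a set \<Rightarrow> ('a \<Rightarrow> real) \<Rightarrow> bool"
  where "smooth_fun_on A W f \<longleftrightarrow> (\<forall>(U, \<phi>)\<in>A. smooth_on (f \<circ> inv_into U \<phi>) (\<phi> ` (U \<inter> W)))"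

abbreviation smooth_funs ::
  "('a::{t2_space, second_countable_topology}, 'e::euclidean_space) chart set \<Rightarrow> ('a \<Rightarrow> real) set"
  where "smooth_funs A \<equiv> {f. smooth_fun_on A UNIV f}"

section \<open>Tangent vectors, vector fields and distributions\<close>

type_synonym 'a tangent = "('a \<Rightarrow> real) \<Rightarrow> real"
type_synonym 'a vfield = "'a \<Rightarrow> 'a tangent"
type_synonym 'a tensor2 = "'a \<Rightarrow> 'a tangent \<Rightarrow> 'a tangent \<Rightarrow> real"

text \<open>Tangent vectors are point derivations of the algebra of smooth functions, extended by
  zero to the non-smooth functions so that equality of tangent vectors is equality in HOL.\<close>

definition tangent_space ::
  "('a::{t2_space, second_countable_topology}, 'e::euclidean_space) chart set
     \<Rightarrow> 'a \<Rightarrow> 'a tangent set" where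
  "tangent_space A p = {v.
     (\<forall>f\<in>smooth_funs A. \<forall>h\<in>smooth_funs A. v (f + h) = v f + v h) \<and>
     (\<forall>c. \<forall>f\<in>smooth_funs A. v (c *\<^sub>R f) = c * v f) \<and>
     (\<forall>f\<in>smooth_funs A. \<forall>h\<in>smooth_funs A. v (f * h) = f p * v h + h p * v f) \<and>
     (\<forall>f. f \<notin> smooth_funs A \<longrightarrow> v f = 0)}"

text \<open>Smooth sections over the open set \<open>U\<close> of a family \<open>E\<close> of subspaces of the tangent
  spaces; the values outside \<open>U\<close> are irrelevant.\<close>

definition sections_on ::
  "('a::{t2_space, second_countable_topology}, 'e::euclidean_space) chart set
     \<Rightarrow> ('a \<Rightarrow> 'a tangent set) \<Rightarrow> 'a set \<Rightarrow> 'a vfield set" where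
  "sections_on A E U =
     {X. (\<forall>p\<in>U. X p \<in> E p) \<and> (\<forall>f\<in>smooth_funs A. smooth_fun_on A U (\<lambda>p. X p f))}"

abbreviation sections ::
  "('a::{t2_space, second_countable_topology}, 'e::euclidean_space) chart set
     \<Rightarrow> ('a \<Rightarrow> 'a tangent set) \<Rightarrow> 'a vfield set"
  where "sections A E \<equiv> sections_on A E UNIV"

definition vderiv :: "'a vfield \<Rightarrow> ('a \<Rightarrow> real) \<Rightarrow> 'a \<Rightarrow> real"
  where "vderiv X f = (\<lambda>p. X p f)"

definition fmult :: "('a \<Rightarrow> real) \<Rightarrow> 'a vfield \<Rightarrow> 'a vfield"
  where "fmult f X = (\<lambda>p. f p *\<^sub>R X p)"

definition lie_bracket :: "'a vfield \<Rightarrow> 'a vfield \<Rightarrow> 'a vfield"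
  where "lie_bracket X Y = (\<lambda>p f. X p (vderiv Y f) - Y p (vderiv X f))"

definition local_frame ::
  "('a::{t2_space, second_countable_topology}, 'e::euclidean_space) chart set
     \<Rightarrow> nat \<Rightarrow> ('a \<Rightarrow> 'a tangent set) \<Rightarrow> 'a set \<Rightarrow> (nat \<Rightarrow> 'a vfield) \<Rightarrow> bool" where
  "local_frame A k E U F \<longleftrightarrow>
     open U \<and> (\<forall>i<k. F i \<in> sections_on A E U) \<and>
     (\<forall>q\<in>U. inj_on (\<lambda>i. F i q) {..<k} \<and> independent ((\<lambda>i. F i q) ` {..<k}) \<and>
        span ((\<lambda>i. F i q) ` {..<k}) = E q)"

definition distribution ::
  "('a::{t2_space, second_countable_topology}, 'e::euclidean_space) chart set
     \<Rightarrow> nat \<Rightarrow> ('a \<Rightarrow> 'a tangent set) \<Rightarrow> bool" where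
  "distribution A k E \<longleftrightarrow>
     (\<forall>p. subspace (E p) \<and> E p \<subseteq> tangent_space A p) \<and>
     (\<forall>p. \<exists>U F. p \<in> U \<and> local_frame A k E U F)"

definition complementary ::
  "('a::{t2_space, second_countable_topology}, 'e::euclidean_space) chart set
     \<Rightarrow> ('a \<Rightarrow> 'a tangent set) \<Rightarrow> ('a \<Rightarrow> 'a tangent set) \<Rightarrow> bool" where
  "complementary A E E' \<longleftrightarrow>
     (\<forall>p. E p \<inter> E' p = {0} \<and> tangent_space A p = {u + v | u v. u \<in> E p \<and> v \<in> E' p})"

section \<open>Metrics and the Levi-Civita connection\<close>

definition fibre_metric ::
  "('a::{t2_space, second_countable_topology}, 'e::euclidean_space) chart set
     \<Rightarrow> ('a \<Rightarrow> 'a tangent set) \<Rightarrow> 'a tensor2 \<Rightarrow> bool" where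
  "fibre_metric A E g \<longleftrightarrow>
     (\<forall>p. \<forall>u\<in>E p. \<forall>v\<in>E p. g p u v = g p v u) \<and>
     (\<forall>p. \<forall>u\<in>E p. \<forall>v\<in>E p. \<forall>w\<in>E p. g p (u + v) w = g p u w + g p v w) \<and>
     (\<forall>p c. \<forall>u\<in>E p. \<forall>w\<in>E p. g p (c *\<^sub>R u) w = c * g p u w) \<and>
     (\<forall>p. \<forall>u\<in>E p. u \<noteq> 0 \<longrightarrow> g p u u > 0) \<and>
     (\<forall>X\<in>sections A E. \<forall>Y\<in>sections A E. smooth_fun_on A UNIV (\<lambda>p. g p (X p) (Y p)))"

abbreviation riemannian_metric ::
  "('a::{t2_space, second_countable_topology}, 'e::euclidean_space) chart set
     \<Rightarrow> 'a tensor2 \<Rightarrow> bool"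
  where "riemannian_metric A g \<equiv> fibre_metric A (tangent_space A) g"

definition affine_connection ::
  "('a::{t2_space, second_countable_topology}, 'e::euclidean_space) chart set
     \<Rightarrow> ('a vfield \<Rightarrow> 'a vfield \<Rightarrow> 'a vfield) \<Rightarrow> bool" where
  "affine_connection A nabla \<longleftrightarrow> (let VF = sections A (tangent_space A) in
     (\<forall>X\<in>VF. \<forall>Y\<in>VF. nabla X Y \<in> VF) \<and>
     (\<forall>X\<in>VF. \<forall>Y\<in>VF. \<forall>Z\<in>VF. nabla (X + Y) Z = nabla X Z + nabla Y Z) \<and>
     (\<forall>X\<in>VF. \<forall>Y\<in>VF. \<forall>Z\<in>VF. nabla X (Y + Z) = nabla X Y + nabla X Z) \<and>
     (\<forall>f\<in>smooth_funs A. \<forall>X\<in>VF. \<forall>Y\<in>VF. nabla (fmult f X) Y = fmult f (nabla X Y)) \<and>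
     (\<forall>f\<in>smooth_funs A. \<forall>X\<in>VF. \<forall>Y\<in>VF.
        nabla X (fmult f Y) = fmult (vderiv X f) Y + fmult f (nabla X Y)))"

definition levi_civita ::
  "('a::{t2_space, second_countable_topology}, 'e::euclidean_space) chart set
     \<Rightarrow> 'a tensor2 \<Rightarrow> ('a vfield \<Rightarrow> 'a vfield \<Rightarrow> 'a vfield) \<Rightarrow> bool" where
  "levi_civita A g nabla \<longleftrightarrow> affine_connection A nabla \<and>
     (let VF = sections A (tangent_space A) in
       (\<forall>X\<in>VF. \<forall>Y\<in>VF. nabla X Y - nabla Y X = lie_bracket X Y) \<and>
       (\<forall>X\<in>VF. \<forall>Y\<in>VF. \<forall>Z\<in>VF. \<forall>p.
          vderiv X (\<lambda>q. g q (Y q) (Z q)) p = g p (nabla X Y p) (Z p) + g p (Y p) (nabla X Z p)))"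

section \<open>Sub-Riemannian manifolds and the horizontal connection\<close>

definition sub_riemannian_manifold ::
  "('a::{t2_space, second_countable_topology}, 'e::euclidean_space) chart set
     \<Rightarrow> nat \<Rightarrow> ('a \<Rightarrow> 'a tangent set) \<Rightarrow> 'a tensor2 \<Rightarrow> bool" where
  "sub_riemannian_manifold A k E gc \<longleftrightarrow>
     smooth_atlas A \<and> k < DIM('e) \<and> distribution A k E \<and> fibre_metric A E gc"

definition orthogonal_extension ::
  "('a::{t2_space, second_countable_topology}, 'e::euclidean_space) chart set
     \<Rightarrow> ('a \<Rightarrow> 'a tangent set) \<Rightarrow> ('a \<Rightarrow> 'a tangent set) \<Rightarrow> 'a tensor2 \<Rightarrow> 'a tensor2 \<Rightarrow> bool" where
  "orthogonal_extension A E E' gc g \<longleftrightarrow>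
     riemannian_metric A g \<and>
     (\<forall>p. \<forall>u\<in>E p. \<forall>v\<in>E p. g p u v = gc p u v) \<and>
     (\<forall>p. \<forall>u\<in>E p. \<forall>v\<in>E' p. g p u v = 0)"

definition orthonormal_frame ::
  "('a::{t2_space, second_countable_topology}, 'e::euclidean_space) chart set
     \<Rightarrow> nat \<Rightarrow> ('a \<Rightarrow> 'a tangent set) \<Rightarrow> 'a tensor2 \<Rightarrow> 'a set \<Rightarrow> (nat \<Rightarrow> 'a vfield) \<Rightarrow> bool" where
  "orthonormal_frame A k E gc U F \<longleftrightarrow>
     local_frame A k E U F \<and>
     (\<forall>q\<in>U. \<forall>i<k. \<forall>j<k. gc q (F i q) (F j q) = (if i = j then 1 else 0))"

text \<open>Local orthonormal frames exist around every point and the sum does not depend on the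
  frame, which is what the definite description expresses.\<close>

definition horizontal_connection ::
  "('a::{t2_space, second_countable_topology}, 'e::euclidean_space) chart set
     \<Rightarrow> nat \<Rightarrow> ('a \<Rightarrow> 'a tangent set) \<Rightarrow> 'a tensor2 \<Rightarrow> 'a tensor2
     \<Rightarrow> ('a vfield \<Rightarrow> 'a vfield \<Rightarrow> 'a vfield) \<Rightarrow> 'a vfield \<Rightarrow> 'a vfield \<Rightarrow> 'a vfield" where
  "horizontal_connection A k E gc g nabla X Y = (\<lambda>p. THE v.
     \<exists>U F. p \<in> U \<and> orthonormal_frame A k E gc U F \<and>
       v = (\<Sum>i<k. g p (nabla X Y p) (F i p) *\<^sub>R F i p))"

end

theory Submission
  imports Defs
begin

text \<open>The Koszul formula expresses \<open>g(\<nabla>\<^sub>X Y, Z)\<close> through derivatives of the functions \<open>g(X, Y)\<close>,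
  \<open>g(X, Z)\<close>, \<open>g(Y, Z)\<close> and through products of one of \<open>X\<close>, \<open>Y\<close>, \<open>Z\<close> with the Lie bracket of the
  other two. If all three fields lie in \<open>\<Delta>\<close>, then every one of these terms is a product \<open>g(t, z)\<close> of
  a tangent vector \<open>t\<close> with some \<open>z \<in> \<Delta>\<close>. The complement is orthogonal to \<open>\<Delta>\<close>, so that
  \<open>g(t, z) = g\<^sub>c(t', z)\<close> with \<open>t'\<close> the projection of \<open>t\<close> to \<open>\<Delta>\<close> along the complement; this does
  not depend on the extension \<open>g\<close> (\<open>orthogonal_extensions_agree\<close>). Hence
  \<open>g\<^sub>1(\<nabla>\<^sub>1 X Y, Z) = g\<^sub>2(\<nabla>\<^sub>2 X Y, Z)\<close> for all global sections \<open>X\<close>, \<open>Y\<close>, \<open>Z\<close> of \<open>\<Delta>\<close>.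

  In the definition of the horizontal connection the third field is a member \<open>F i\<close> of a frame over
  some open set only, whereas connections act on global fields. Both sides depend on the third
  field only through its value at the point, so it suffices that some global section of \<open>\<Delta>\<close> takes
  the value of \<open>F i\<close> there (\<open>local_section_extends\<close>). Such a section is \<open>F i\<close> times a bump function
  (\<open>manifold_bump\<close>). The construction of the bump, starting from \<open>exp (-1 / x)\<close>, and the product
  and chain rules that it needs occupy most of the text. The coefficients then agree in every
  orthonormal frame, so the two definite descriptions have the same defining property.\<close>

section \<open>Calculus of continuously differentiable functions\<close>

lemma Ck_on_subset: "Ck_on n f S \<Longrightarrow> T \<subseteq> S \<Longrightarrow> Ck_on n f T"
  by (induction n arbitrary: f) (auto intro: continuous_on_subset)

lemma Ck_on_Suc_imp: "Ck_on (Suc n) f S \<Longrightarrow> Ck_on n f S"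
proof (induction n arbitrary: f)
  case 0
  then show ?case
    by (auto intro!: continuous_at_imp_continuous_on differentiable_imp_continuous_within)
next
  case (Suc n)
  then show ?case by (metis Ck_on.simps(2))
qed

text \<open>On an open set the values on the set determine the derivatives there.\<close>

lemma Ck_on_cong:
  assumes "open S" "Ck_on n f S" "\<And>x. x \<in> S \<Longrightarrow> f x = g x"
  shows "Ck_on n g S"
  using assms(2,3)
proof (induction n arbitrary: f g)
  case 0
  then show ?case by (metis Ck_on.simps(1) continuous_on_cong)
next
  case (Suc n)
  have d: "g differentiable (at x)" if "x \<in> S" for x
    using Suc.prems that \<open>open S\<close>
    by (metis Ck_on.simps(2) differentiable_def has_derivative_transform_within_open)
  have e: "frechet_derivative f (at x) = frechet_derivative g (at x)" if "x \<in> S" for x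
    using Suc.prems that \<open>open S\<close>
    by (metis Ck_on.simps(2) frechet_derivative_transform_within_open)
  show ?case
    using d e Suc.prems(1) Suc.IH[of "\<lambda>x. frechet_derivative f (at x) v"
      "\<lambda>x. frechet_derivative g (at x) v" for v] by simp
qed

lemma Ck_on_local:
  assumes "\<And>x. x \<in> S \<Longrightarrow> \<exists>T. open T \<and> x \<in> T \<and> Ck_on n f T"
  shows "Ck_on n f S"
  using assms
proof (induction n arbitrary: f)
  case 0
  then show ?case
    by (metis Ck_on.simps(1) continuous_at_imp_continuous_on continuous_on_eq_continuous_at)
next
  case (Suc n)
  have "Ck_on n (\<lambda>x. frechet_derivative f (at x) v) S" for v
    by (rule Suc.IH) (use Suc.prems in fastforce)
  moreover have "f differentiable (at x)" if "x \<in> S" for x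
    using Suc.prems[OF that] by auto
  ultimately show ?case by simp
qed

text \<open>The definition of higher differentiability refers to a derivative chosen by a description.
  Here any explicit formula for the derivative may be used in its place.\<close>

lemma Ck_on_SucI:
  assumes "open S" "\<And>x. x \<in> S \<Longrightarrow> (f has_derivative f' x) (at x)"
    and "\<And>v. Ck_on n (\<lambda>x. f' x v) S"
  shows "Ck_on (Suc n) f S"
proof -
  have "f' x = frechet_derivative f (at x)" if "x \<in> S" for x
    using assms(2)[OF that] by (rule frechet_derivative_at)
  then have "Ck_on n (\<lambda>x. frechet_derivative f (at x) v) S" for v
    using Ck_on_cong[OF assms(1) assms(3)[of v]] by simp
  then show ?thesis using assms(2) by (auto simp: differentiable_def)
qed

lemma Ck_on_Suc_derivative:
  assumes "Ck_on (Suc n) f S" "x \<in> S"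
  shows "(f has_derivative frechet_derivative f (at x)) (at x)"
  using assms by (simp add: frechet_derivative_works)

lemma Ck_on_const: "open S \<Longrightarrow> Ck_on n (\<lambda>x. c) S"
proof (induction n arbitrary: c)
  case (Suc n)
  then show ?case by (intro Ck_on_SucI[where f' = "\<lambda>x v. 0"]) auto
qed simp

lemma Ck_on_id: "open S \<Longrightarrow> Ck_on n (\<lambda>x. x) S"
  by (cases n) (auto intro!: Ck_on_SucI[where f' = "\<lambda>x v. v"] Ck_on_const)

lemma Ck_on_add:
  "open S \<Longrightarrow> Ck_on n f S \<Longrightarrow> Ck_on n g S \<Longrightarrow> Ck_on n (\<lambda>x. f x + g x) S"
proof (induction n arbitrary: f g)
  case 0
  then show ?case by (auto intro: continuous_on_add)
next
  case (Suc n)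
  show ?case
    using Suc.prems Suc.IH
    by (intro Ck_on_SucI[where f' = "\<lambda>x v. frechet_derivative f (at x) v + frechet_derivative g (at x) v"])
       (auto intro!: has_derivative_add dest: Ck_on_Suc_derivative simp: frechet_derivative_works)
qed

lemma Ck_on_mult:
  fixes f g :: "'e::euclidean_space \<Rightarrow> real"
  shows "open S \<Longrightarrow> Ck_on n f S \<Longrightarrow> Ck_on n g S \<Longrightarrow> Ck_on n (\<lambda>x. f x * g x) S"
proof (induction n arbitrary: f g)
  case 0
  then show ?case by (auto intro: continuous_on_mult)
next
  case (Suc n)
  have "Ck_on n f S" "Ck_on n g S" using Suc.prems(2,3) by (blast intro: Ck_on_Suc_imp)+
  then have lower:
    "Ck_on n (\<lambda>x. f x * frechet_derivative g (at x) v + frechet_derivative f (at x) v * g x) S" for v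
    using Suc.prems by (intro Ck_on_add Suc.IH) auto
  have "((\<lambda>x. f x * g x) has_derivative (\<lambda>v. f x * frechet_derivative g (at x) v
      + frechet_derivative f (at x) v * g x)) (at x)" if "x \<in> S" for x
    using Suc.prems(2,3)[THEN Ck_on_Suc_derivative, OF that] by (rule has_derivative_mult)
  then show ?case using lower by (rule Ck_on_SucI[OF Suc.prems(1)])
qed

lemma Ck_on_sum:
  assumes "open S" "\<And>i. i \<in> I \<Longrightarrow> Ck_on n (f i) S"
  shows "Ck_on n (\<lambda>x. \<Sum>i\<in>I. f i x) S"
  using assms(2)
  by (induction I rule: infinite_finite_induct) (simp_all add: assms(1) Ck_on_const Ck_on_add)

lemma Ck_on_inner_const:
  fixes g :: "'e::euclidean_space \<Rightarrow> 'f::euclidean_space"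
  shows "open S \<Longrightarrow> Ck_on n g S \<Longrightarrow> Ck_on n (\<lambda>x. g x \<bullet> b) S"
proof (induction n arbitrary: g)
  case 0
  then show ?case by (auto intro!: continuous_intros)
next
  case (Suc n)
  then show ?case
    by (intro Ck_on_SucI[where f' = "\<lambda>x v. frechet_derivative g (at x) v \<bullet> b"]
          has_derivative_inner_left Ck_on_Suc_derivative) auto
qed

text \<open>Expanding the chain rule in an orthonormal basis writes a directional derivative of the
  composite as a sum of products of a composite of the class one lower with a component of the
  inner derivative, so that the induction closes.\<close>

lemma Ck_on_compose:
  fixes g :: "'e::euclidean_space \<Rightarrow> 'f::euclidean_space" and f :: "'f \<Rightarrow> real"
  assumes "open S"
  shows "Ck_on n f T \<Longrightarrow> Ck_on n g S \<Longrightarrow> g ` S \<subseteq> T \<Longrightarrow> Ck_on n (\<lambda>x. f (g x)) S"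
proof (induction n arbitrary: f)
  case 0
  then show ?case using continuous_on_compose2[of T f S g] by simp
next
  case (Suc n)
  let ?f' = "\<lambda>y. frechet_derivative f (at y)" and ?g' = "\<lambda>x. frechet_derivative g (at x)"
  have chain: "((\<lambda>x. f (g x)) has_derivative (\<lambda>v. \<Sum>b\<in>Basis. (?g' x v \<bullet> b) * ?f' (g x) b)) (at x)"
    if "x \<in> S" for x
  proof -
    have f: "(f has_derivative ?f' (g x)) (at (g x))"
      by (rule Ck_on_Suc_derivative[OF Suc.prems(1)]) (use Suc.prems(3) that in blast)
    have expand: "?f' (g x) w = (\<Sum>b\<in>Basis. (w \<bullet> b) * ?f' (g x) b)" for w
    proof -
      interpret linear "?f' (g x)" using f by (rule has_derivative_linear)
      have "?f' (g x) w = ?f' (g x) (\<Sum>b\<in>Basis. (w \<bullet> b) *\<^sub>R b)"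
        by (simp add: euclidean_representation)
      also have "\<dots> = (\<Sum>b\<in>Basis. (w \<bullet> b) * ?f' (g x) b)" by (simp add: sum scaleR)
      finally show ?thesis .
    qed
    have "((\<lambda>x. f (g x)) has_derivative (\<lambda>v. ?f' (g x) (?g' x v))) (at x)"
      using Ck_on_Suc_derivative[OF Suc.prems(2) that] f by (rule has_derivative_compose)
    then show ?thesis by (simp only: expand[symmetric])
  qed
  have outer: "Ck_on n (\<lambda>x. ?f' (g x) b) S" for b
    by (rule Suc.IH[OF _ Ck_on_Suc_imp[OF Suc.prems(2)] Suc.prems(3)]) (use Suc.prems(1) in simp)
  have inner: "Ck_on n (\<lambda>x. ?g' x v) S" for v
    using Suc.prems(2) by simp
  have "Ck_on n (\<lambda>x. \<Sum>b\<in>Basis. (?g' x v \<bullet> b) * ?f' (g x) b) S" for v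
    by (intro Ck_on_sum Ck_on_mult[OF _ Ck_on_inner_const[OF _ inner] outer] assms)
  with chain show ?case by (rule Ck_on_SucI[OF assms])
qed

section \<open>Bump functions on Euclidean space\<close>

text \<open>The case \<open>P = 1\<close> is the classical smooth function \<open>exp (-1 / x)\<close>, flat at the origin. The
  polynomial factor makes the family closed under differentiation, so that smoothness of all its
  members follows by one induction.\<close>

definition flat_fun :: "real poly \<Rightarrow> real \<Rightarrow> real" where
  "flat_fun P x = (if x > 0 then poly P (1 / x) * exp (- (1 / x)) else 0)"

lemma poly_times_exp_minus_tendsto_0:
  "((\<lambda>y::real. poly P y * exp (- y)) \<longlongrightarrow> 0) at_top"
proof -
  have "((\<lambda>y::real. coeff P i * (y ^ i / exp y)) \<longlongrightarrow> 0) at_top" for i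
    using tendsto_mult_right_zero[OF tendsto_power_div_exp_0] by blast
  then have "((\<lambda>y::real. \<Sum>i\<le>degree P. coeff P i * (y ^ i / exp y)) \<longlongrightarrow> 0) at_top"
    by (rule tendsto_null_sum)
  moreover have "(\<Sum>i\<le>degree P. coeff P i * (y ^ i / exp y)) = poly P y * exp (- y)" for y :: real
    by (simp add: poly_altdef sum_distrib_right exp_minus divide_inverse mult.assoc)
  ultimately show ?thesis by simp
qed

lemma flat_fun_tendsto_0: "(flat_fun P \<longlongrightarrow> 0) (at 0)"
proof -
  have "((\<lambda>x. poly P (1 / x) * exp (- (1 / x))) \<longlongrightarrow> 0) (at_right (0::real))"
    using filterlim_compose[OF poly_times_exp_minus_tendsto_0 filterlim_inverse_at_top_right]
    by (simp add: inverse_eq_divide)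
  then have "(flat_fun P \<longlongrightarrow> 0) (at_right 0)"
    by (rule Lim_transform_eventually)
       (auto simp: eventually_at_right_field flat_fun_def intro!: exI[of _ 1])
  moreover have "(flat_fun P \<longlongrightarrow> 0) (at_left 0)"
    by (rule Lim_transform_eventually[OF tendsto_const])
       (auto simp: eventually_at_left_field flat_fun_def intro!: exI[of _ "-1"])
  ultimately show ?thesis by (simp add: filterlim_split_at)
qed

text \<open>For positive \<open>x\<close> put \<open>y = 1 / x\<close>; since \<open>y\<close> has derivative \<open>- y\<^sup>2\<close>, the derivative of
  \<open>P(y) exp (- y)\<close> is \<open>y\<^sup>2 (P(y) - P'(y)) exp (- y)\<close>. At the origin the difference quotient of a member of the family is the member whose
  polynomial carries one more factor, so its limit is again zero.\<close>

lemma flat_fun_derivative: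
  "(flat_fun P has_real_derivative flat_fun ([:0, 0, 1:] * (P - pderiv P)) x) (at x)"
proof -
  consider "x > 0" | "x = 0" | "x < 0" by linarith
  then show ?thesis
  proof cases
    case 1
    have "((\<lambda>x. poly P (1 / x) * exp (- (1 / x))) has_real_derivative
        flat_fun ([:0, 0, 1:] * (P - pderiv P)) x) (at x)"
      using 1 by (auto intro!: derivative_eq_intros DERIV_chain2[OF poly_DERIV]
          simp: flat_fun_def field_simps power2_eq_square)
    then show ?thesis
      by (rule has_field_derivative_transform_within_open[where S = "{0<..}"])
         (use 1 in \<open>auto simp: flat_fun_def\<close>)
  next
    case 2
    have "flat_fun P h / h = flat_fun ([:0, 1:] * P) h" for h
      by (simp add: flat_fun_def)
    then have "((\<lambda>h. (flat_fun P (0 + h) - flat_fun P 0) / h) \<longlongrightarrow> 0) (at 0)"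
      using flat_fun_tendsto_0[of "[:0, 1:] * P"] by (simp add: flat_fun_def[of P 0])
    then show ?thesis using 2 by (simp add: DERIV_def flat_fun_def[of _ 0])
  next
    case 3
    have "((\<lambda>x. 0) has_real_derivative flat_fun ([:0, 0, 1:] * (P - pderiv P)) x) (at x)"
      using 3 by (simp add: flat_fun_def)
    then show ?thesis
      by (rule has_field_derivative_transform_within_open[where S = "{..<0}"])
         (use 3 in \<open>auto simp: flat_fun_def\<close>)
  qed
qed

lemma Ck_on_flat_fun: "Ck_on n (flat_fun P) UNIV"
proof (induction n arbitrary: P)
  case 0
  show ?case
    using flat_fun_derivative by (auto intro!: continuous_at_imp_continuous_on DERIV_isCont)
next
  case (Suc n)
  then show ?case
    by (intro Ck_on_SucI[where f' = "\<lambda>x v. flat_fun ([:0, 0, 1:] * (P - pderiv P)) x * v"]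
          Ck_on_mult Ck_on_const)
       (use flat_fun_derivative in \<open>auto simp: has_field_derivative_def\<close>)
qed

lemma euclidean_bump:
  fixes x0 :: "'e::euclidean_space"
  assumes "r > 0"
  obtains h :: "'e \<Rightarrow> real"
  where "smooth_on h UNIV" "h x0 = 1" "\<And>x. x \<notin> cball x0 r \<Longrightarrow> h x = 0"
proof
  \<comment> \<open>The squared distance is written as a sum of squares of coordinates in order to be visibly
    smooth.\<close>
  define s where "s = (\<lambda>x::'e. r\<^sup>2 - (\<Sum>b\<in>Basis. ((x - x0) \<bullet> b) * ((x - x0) \<bullet> b)))"
  have s: "s x = r\<^sup>2 - (dist x0 x)\<^sup>2" for x
    by (simp add: s_def euclidean_inner[symmetric] dist_norm norm_minus_commute[of x0] power2_norm_eq_inner)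
  \<comment> \<open>The factor normalises the value at the centre, where the argument of the flat function is
    the square of the radius.\<close>
  define h where "h = (\<lambda>x. exp (1 / r\<^sup>2) * flat_fun 1 (s x))"
  have "Ck_on n (\<lambda>x::'e. x - x0) UNIV" for n
    using Ck_on_add[OF open_UNIV Ck_on_id Ck_on_const[of _ _ "- x0"]] by simp
  then have "Ck_on n (\<lambda>x::'e. r\<^sup>2 + (-1) * (\<Sum>b\<in>Basis. ((x - x0) \<bullet> b) * ((x - x0) \<bullet> b))) UNIV" for n
    by (intro Ck_on_add Ck_on_mult Ck_on_sum Ck_on_inner_const Ck_on_const open_UNIV) auto
  then have "Ck_on n s UNIV" for n by (simp add: s_def)
  then have "Ck_on n h UNIV" for n
    unfolding h_def
    by (intro Ck_on_mult Ck_on_const Ck_on_compose[OF _ Ck_on_flat_fun] open_UNIV) auto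
  then show "smooth_on h UNIV" by (simp add: smooth_on_def)
  show "h x0 = 1"
    using assms by (simp add: h_def s flat_fun_def exp_minus)
  show "h x = 0" if "x \<notin> cball x0 r" for x
  proof -
    have "r\<^sup>2 \<le> (dist x0 x)\<^sup>2" using that assms by (intro power_mono) auto
    then show ?thesis by (simp add: h_def s flat_fun_def)
  qed
qed

section \<open>Smooth functions and bump functions on a manifold\<close>

lemma smooth_atlasD:
  assumes "smooth_atlas A" "(U, \<phi>) \<in> A"
  shows "open U" "open (\<phi> ` U)" "homeomorphism U (\<phi> ` U) \<phi> (inv_into U \<phi>)" "inj_on \<phi> U"
proof -
  show *: "open U" "open (\<phi> ` U)" "homeomorphism U (\<phi> ` U) \<phi> (inv_into U \<phi>)"
    using assms by (auto simp: smooth_atlas_def)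
  show "inj_on \<phi> U" using *(3) by (metis homeomorphism_def inj_on_inverseI)
qed

lemma open_chart_image:
  assumes "smooth_atlas A" "(U, \<phi>) \<in> A" "open W"
  shows "open (\<phi> ` (U \<inter> W))"
proof -
  note c = smooth_atlasD[OF assms(1,2)]
  have "openin (top_of_set (\<phi> ` U)) (\<phi> ` (U \<inter> W))"
    using c(3) by (rule homeomorphism_imp_open_map) (use assms(3) in auto)
  then show ?thesis using c(2) openin_open_trans by blast
qed

lemma smooth_fun_on_cong:
  assumes "smooth_atlas A" "open W" "smooth_fun_on A W f" "\<And>q. q \<in> W \<Longrightarrow> f q = h q"
  shows "smooth_fun_on A W h"
  unfolding smooth_fun_on_def
proof safe
  fix U \<phi> assume c: "(U, \<phi>) \<in> A"
  then have "Ck_on n (f \<circ> inv_into U \<phi>) (\<phi> ` (U \<inter> W))" for n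
    using assms(3) by (auto simp: smooth_fun_on_def smooth_on_def)
  then have "Ck_on n (h \<circ> inv_into U \<phi>) (\<phi> ` (U \<inter> W))" for n
    by (rule Ck_on_cong[OF open_chart_image[OF assms(1) c assms(2)]])
       (use assms(4) smooth_atlasD(4)[OF assms(1) c] in auto)
  then show "smooth_on (h \<circ> inv_into U \<phi>) (\<phi> ` (U \<inter> W))" by (simp add: smooth_on_def)
qed

lemma smooth_fun_on_mult:
  assumes "smooth_atlas A" "open W" "smooth_fun_on A W f" "smooth_fun_on A W h"
  shows "smooth_fun_on A W (\<lambda>q. f q * h q)"
  unfolding smooth_fun_on_def
proof safe
  fix U \<phi> assume c: "(U, \<phi>) \<in> A"
  then have "Ck_on n (f \<circ> inv_into U \<phi>) (\<phi> ` (U \<inter> W))" "Ck_on n (h \<circ> inv_into U \<phi>) (\<phi> ` (U \<inter> W))" for n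
    using assms(3,4) by (auto simp: smooth_fun_on_def smooth_on_def)
  from Ck_on_mult[OF open_chart_image[OF assms(1) c assms(2)] this]
  show "smooth_on ((\<lambda>q. f q * h q) \<circ> inv_into U \<phi>) (\<phi> ` (U \<inter> W))"
    by (simp add: smooth_on_def o_def)
qed

lemma smooth_fun_on_zero: "smooth_atlas A \<Longrightarrow> open W \<Longrightarrow> smooth_fun_on A W (\<lambda>q. 0)"
  by (auto simp: smooth_fun_on_def smooth_on_def o_def intro!: Ck_on_const open_chart_image)

lemma smooth_fun_on_subset: "smooth_fun_on A W f \<Longrightarrow> W' \<subseteq> W \<Longrightarrow> smooth_fun_on A W' f"
  unfolding smooth_fun_on_def smooth_on_def by (fast intro: Ck_on_subset)

lemma smooth_fun_on_Un:
  assumes "smooth_atlas A" "open V" "open W" "smooth_fun_on A V f" "smooth_fun_on A W f"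
  shows "smooth_fun_on A (V \<union> W) f"
  unfolding smooth_fun_on_def
proof safe
  fix U \<phi> assume c: "(U, \<phi>) \<in> A"
  have "Ck_on n (f \<circ> inv_into U \<phi>) (\<phi> ` (U \<inter> V))" "Ck_on n (f \<circ> inv_into U \<phi>) (\<phi> ` (U \<inter> W))" for n
    using assms(4,5) c by (auto simp: smooth_fun_on_def smooth_on_def)
  then have "Ck_on n (f \<circ> inv_into U \<phi>) (\<phi> ` (U \<inter> (V \<union> W)))" for n
    using open_chart_image[OF assms(1) c assms(2)] open_chart_image[OF assms(1) c assms(3)]
    by (intro Ck_on_local) (auto 0 4)
  then show "smooth_on (f \<circ> inv_into U \<phi>) (\<phi> ` (U \<inter> (V \<union> W)))" by (simp add: smooth_on_def)
qed

text \<open>The extension is smooth on \<open>W\<close> and vanishes on the complement of \<open>K\<close>; these two open sets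
  cover the manifold.\<close>

lemma smooth_fun_extend_by_zero:
  assumes "smooth_atlas A" "open W" "closed K" "K \<subseteq> W" "smooth_fun_on A W f"
    and "\<And>q. q \<in> W - K \<Longrightarrow> f q = 0"
  shows "smooth_fun_on A UNIV (\<lambda>q. if q \<in> W then f q else 0)"
proof -
  let ?F = "\<lambda>q. if q \<in> W then f q else 0"
  have "smooth_fun_on A W ?F"
    using assms(1,2,5) by (rule smooth_fun_on_cong) auto
  moreover have "smooth_fun_on A (- K) ?F"
    using assms(1) open_Compl[OF assms(3)] smooth_fun_on_zero[OF assms(1) open_Compl[OF assms(3)]]
    by (rule smooth_fun_on_cong) (use assms(6) in auto)
  ultimately have "smooth_fun_on A (W \<union> - K) ?F"
    using assms(1-3) by (intro smooth_fun_on_Un) auto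
  moreover have "W \<union> - K = UNIV" using assms(4) by auto
  ultimately show ?thesis by simp
qed

text \<open>The bump is a Euclidean one read through a chart. Its support is the homeomorphic image of a
  closed ball, hence compact, hence closed because the manifold is Hausdorff; this is what makes
  the extension by zero smooth.\<close>

lemma manifold_bump:
  fixes A :: "('a::{t2_space, second_countable_topology}, 'e::euclidean_space) chart set"
  assumes A: "smooth_atlas A" and W: "open W" "p \<in> W"
  obtains b K where "smooth_fun_on A UNIV b" "b p = 1" "closed K" "K \<subseteq> W" "\<And>q. q \<notin> K \<Longrightarrow> b q = 0"
proof -
  have "p \<in> (\<Union>(U, \<phi>)\<in>A. U)" using A unfolding smooth_atlas_def by simp
  then obtain V \<phi> where c: "(V, \<phi>) \<in> A" and p: "p \<in> V" by blast
  note ch = smooth_atlasD[OF A c]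
  obtain r where r: "r > 0" and rsub: "cball (\<phi> p) r \<subseteq> \<phi> ` (V \<inter> W)"
    using open_contains_cball[THEN iffD1, OF open_chart_image[OF A c W(1)], rule_format, of "\<phi> p"]
      p W(2) by blast
  obtain h :: "'e \<Rightarrow> real" where h: "smooth_on h UNIV" "h (\<phi> p) = 1"
    "\<And>x. x \<notin> cball (\<phi> p) r \<Longrightarrow> h x = 0"
    using euclidean_bump[OF r] by metis
  define K where "K = inv_into V \<phi> ` cball (\<phi> p) r"
  have "compact K"
    unfolding K_def using ch(3) rsub
    by (intro compact_continuous_image) (auto simp: homeomorphism_def intro: continuous_on_subset)
  then have "closed K" by (rule compact_imp_closed)
  have KVW: "K \<subseteq> V \<inter> W"
    using rsub ch(4) by (fastforce simp: K_def)
  have out: "h (\<phi> q) = 0" if "q \<in> V - K" for q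
    using that ch(4) h(3)[of "\<phi> q"] by (force simp: K_def)
  have "smooth_fun_on A V (\<lambda>q. h (\<phi> q))"
    unfolding smooth_fun_on_def
  proof safe
    fix U \<psi> assume c': "(U, \<psi>) \<in> A"
    have "smooth_on (\<phi> \<circ> inv_into U \<psi>) (\<psi> ` (U \<inter> V))"
      using A c c' unfolding smooth_atlas_def by blast
    then show "smooth_on ((\<lambda>q. h (\<phi> q)) \<circ> inv_into U \<psi>) (\<psi> ` (U \<inter> V))"
      using h(1) Ck_on_compose[OF open_chart_image[OF A c' ch(1)], of _ h UNIV "\<phi> \<circ> inv_into U \<psi>"]
      by (simp add: smooth_on_def o_def)
  qed
  then have "smooth_fun_on A UNIV (\<lambda>q. if q \<in> V then h (\<phi> q) else 0)"
    using A ch(1) \<open>closed K\<close> KVW out by (intro smooth_fun_extend_by_zero[where K = K]) auto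
  then show ?thesis
    by (rule that[where K = K]) (use p h(2) \<open>closed K\<close> KVW out in auto)
qed

text \<open>The Levi-Civita connection acts on globally defined fields only, so the members of a local
  frame have to be replaced by global sections with the same value at the point considered.\<close>

lemma local_section_extends:
  assumes A: "smooth_atlas A" and E: "\<And>q. subspace (E q)"
    and U: "open U" "p \<in> U" and F: "F \<in> sections_on A E U"
  obtains Z where "Z \<in> sections A E" "Z p = F p"
proof -
  obtain b K where b: "smooth_fun_on A UNIV b" "b p = 1" "closed K" "K \<subseteq> U" "\<And>q. q \<notin> K \<Longrightarrow> b q = 0"
    using manifold_bump[OF A U] by blast
  define Z where "Z = (\<lambda>q. if q \<in> U then b q *\<^sub>R F q else 0)"
  have "smooth_fun_on A UNIV (\<lambda>q. Z q f)" if "f \<in> smooth_funs A" for f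
  proof -
    have "smooth_fun_on A U (\<lambda>q. b q * F q f)"
      using F that smooth_fun_on_subset[OF b(1), of U]
      by (intro smooth_fun_on_mult A U) (auto simp: sections_on_def)
    then have "smooth_fun_on A UNIV (\<lambda>q. if q \<in> U then b q * F q f else 0)"
      using A U b by (intro smooth_fun_extend_by_zero[where K = K]) auto
    moreover have "(\<lambda>q. Z q f) = (\<lambda>q. if q \<in> U then b q * F q f else 0)"
      by (auto simp: Z_def scaleR_fun_def)
    ultimately show ?thesis by simp
  qed
  then have "Z \<in> sections A E"
    using F E by (auto simp: sections_on_def Z_def intro: subspace_scale subspace_0)
  moreover have "Z p = F p" using U b(2) by (simp add: Z_def)
  ultimately show ?thesis by (rule that)
qed

section \<open>The Koszul formula\<close>

lemma subspace_tangent_space: "subspace (tangent_space A p)"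
  unfolding subspace_def tangent_space_def by (auto simp: scaleR_fun_def algebra_simps)

lemma riemannian_metric_diff_left:
  assumes g: "riemannian_metric A g"
    and "u \<in> tangent_space A p" "v \<in> tangent_space A p" "w \<in> tangent_space A p"
  shows "g p (u - v) w = g p u w - g p v w"
proof -
  have "u - v \<in> tangent_space A p"
    using assms subspace_diff[OF subspace_tangent_space] by blast
  then have "g p ((u - v) + v) w = g p (u - v) w + g p v w"
    using g assms(3,4) unfolding fibre_metric_def by blast
  then show ?thesis by simp
qed

text \<open>Add the metric compatibility identities for \<open>X g(Y, Z)\<close> and \<open>Y g(X, Z)\<close> and subtract the one
  for \<open>Z g(X, Y)\<close>. Torsion-freeness turns the differences of covariant derivatives into brackets,
  and only a multiple of \<open>g(\<nabla>\<^sub>X Y, Z)\<close> remains.\<close>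

lemma koszul_formula:
  assumes g: "riemannian_metric A g" and lc: "levi_civita A g nabla"
    and X: "X \<in> sections A (tangent_space A)" and Y: "Y \<in> sections A (tangent_space A)"
    and Z: "Z \<in> sections A (tangent_space A)"
  shows "2 * g p (nabla X Y p) (Z p) =
      vderiv X (\<lambda>q. g q (Y q) (Z q)) p + vderiv Y (\<lambda>q. g q (X q) (Z q)) p
      - vderiv Z (\<lambda>q. g q (X q) (Y q)) p
      + g p (lie_bracket X Y p) (Z p) - g p (lie_bracket X Z p) (Y p)
      - g p (lie_bracket Y Z p) (X p)"
proof -
  let ?VF = "sections A (tangent_space A)"
  have nabla: "nabla V W p \<in> tangent_space A p" if "V \<in> ?VF" "W \<in> ?VF" for V W
    using lc that by (auto simp: levi_civita_def affine_connection_def Let_def sections_on_def)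
  have val: "V p \<in> tangent_space A p" if "V \<in> ?VF" for V
    using that by (auto simp: sections_on_def)
  have sym: "g p u v = g p v u" if "u \<in> tangent_space A p" "v \<in> tangent_space A p" for u v
    using g that by (auto simp: fibre_metric_def)
  have metric: "vderiv U (\<lambda>q. g q (V q) (W q)) p
      = g p (nabla U V p) (W p) + g p (nabla U W p) (V p)"
    if "U \<in> ?VF" "V \<in> ?VF" "W \<in> ?VF" for U V W
    using lc that sym[OF val nabla, of V U W] by (auto simp: levi_civita_def Let_def)
  have torsion: "g p (lie_bracket U V p) (W p) = g p (nabla U V p) (W p) - g p (nabla V U p) (W p)"
    if "U \<in> ?VF" "V \<in> ?VF" "W \<in> ?VF" for U V W
  proof -
    have "nabla U V - nabla V U = lie_bracket U V"
      using lc that by (simp add: levi_civita_def Let_def)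
    then have "lie_bracket U V p = nabla U V p - nabla V U p" by (metis fun_diff_def)
    then show ?thesis using riemannian_metric_diff_left[OF g] nabla val that by simp
  qed
  show ?thesis
    using metric[OF X Y Z] metric[OF Y X Z] metric[OF Z X Y]
      torsion[OF X Y Z] torsion[OF X Z Y] torsion[OF Y Z X] by simp
qed

section \<open>Independence of the orthogonal extension\<close>

text \<open>Only the horizontal part of a tangent vector contributes to its product with a horizontal
  vector, and on horizontal vectors both metrics are the given one.\<close>

lemma orthogonal_extensions_agree:
  assumes "complementary A E E'"
    and E: "E p \<subseteq> tangent_space A p" "E' p \<subseteq> tangent_space A p"
    and g1: "orthogonal_extension A E E' gc g\<^sub>1" and g2: "orthogonal_extension A E E' gc g\<^sub>2"
    and t: "t \<in> tangent_space A p" and z: "z \<in> E p"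
  shows "g\<^sub>1 p t z = g\<^sub>2 p t z"
proof -
  obtain u v where uv: "t = u + v" "u \<in> E p" "v \<in> E' p"
    using assms(1) t by (auto simp: complementary_def)
  have "g p t z = gc p u z" if g: "orthogonal_extension A E E' gc g" for g
  proof -
    have ts: "u \<in> tangent_space A p" "v \<in> tangent_space A p" "z \<in> tangent_space A p"
      using E uv z by auto
    have m: "riemannian_metric A g" using g by (simp add: orthogonal_extension_def)
    have "g p t z = g p u z + g p v z"
      using m ts unfolding uv(1) fibre_metric_def by blast
    also have "g p v z = g p z v" using m ts unfolding fibre_metric_def by blast
    also have "\<dots> = 0" using g uv z by (simp add: orthogonal_extension_def)
    also have "g p u z = gc p u z" using g uv z by (simp add: orthogonal_extension_def)
    finally show ?thesis by simp
  qed
  from this[OF g1] this[OF g2] show ?thesis by simp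
qed

theorem proposition4p5:
  fixes A :: "('a::{t2_space, second_countable_topology}, 'e::euclidean_space) chart set"
    and k :: nat
    and \<Delta> \<Delta>' :: "'a \<Rightarrow> 'a tangent set"
    and gc g\<^sub>1 g\<^sub>2 :: "'a tensor2"
    and nabla\<^sub>1 nabla\<^sub>2 :: "'a vfield \<Rightarrow> 'a vfield \<Rightarrow> 'a vfield"
  assumes "sub_riemannian_manifold A k \<Delta> gc"
    and "distribution A (DIM('e) - k) \<Delta>'"
    and "complementary A \<Delta> \<Delta>'"
    and "orthogonal_extension A \<Delta> \<Delta>' gc g\<^sub>1" and "levi_civita A g\<^sub>1 nabla\<^sub>1"
    and "orthogonal_extension A \<Delta> \<Delta>' gc g\<^sub>2" and "levi_civita A g\<^sub>2 nabla\<^sub>2"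
  shows "\<forall>X\<in>sections A \<Delta>. \<forall>Y\<in>sections A \<Delta>.
           horizontal_connection A k \<Delta> gc g\<^sub>1 nabla\<^sub>1 X Y
             = horizontal_connection A k \<Delta> gc g\<^sub>2 nabla\<^sub>2 X Y"
proof (intro ballI)
  fix X Y assume X: "X \<in> sections A \<Delta>" and Y: "Y \<in> sections A \<Delta>"
  have A: "smooth_atlas A" and D: "distribution A k \<Delta>"
    using assms(1) by (auto simp: sub_riemannian_manifold_def)
  have sub: "\<And>p. subspace (\<Delta> p)" "\<And>p. \<Delta> p \<subseteq> tangent_space A p" "\<And>p. \<Delta>' p \<subseteq> tangent_space A p"
    using D assms(2) unfolding distribution_def by auto
  have VF: "V \<in> sections A (tangent_space A)" if "V \<in> sections A \<Delta>" for V
    using that sub(2) by (auto simp: sections_on_def)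
  have g: "riemannian_metric A g\<^sub>1" "riemannian_metric A g\<^sub>2"
    using assms(4,6) by (auto simp: orthogonal_extension_def)
  have agree: "g\<^sub>1 p t (Z p) = g\<^sub>2 p t (Z p)" if "t \<in> tangent_space A p" "Z \<in> sections A \<Delta>" for p t Z
    using orthogonal_extensions_agree[OF assms(3) sub(2,3) assms(4,6)] that
    by (auto simp: sections_on_def)
  have koszul: "g\<^sub>1 p (nabla\<^sub>1 X Y p) (Z p) = g\<^sub>2 p (nabla\<^sub>2 X Y p) (Z p)" if Z: "Z \<in> sections A \<Delta>" for p Z
  proof -
    have fields: "(\<lambda>q. g\<^sub>1 q (V q) (W q)) = (\<lambda>q. g\<^sub>2 q (V q) (W q))"
      if "V \<in> sections A \<Delta>" "W \<in> sections A \<Delta>" for V W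
      using agree[OF _ that(2)] VF[OF that(1)] by (auto simp: sections_on_def)
    \<comment> \<open>Brackets of horizontal fields need not be horizontal. That they are tangent is read off
      from torsion-freeness instead of being computed.\<close>
    have "lie_bracket V W p \<in> tangent_space A p"
      if "V \<in> sections A \<Delta>" "W \<in> sections A \<Delta>" for V W
    proof -
      have "lie_bracket V W = nabla\<^sub>1 V W - nabla\<^sub>1 W V"
        using assms(5) VF that by (simp add: levi_civita_def Let_def)
      then have "lie_bracket V W p = nabla\<^sub>1 V W p - nabla\<^sub>1 W V p" by simp
      moreover have "nabla\<^sub>1 V W p \<in> tangent_space A p" "nabla\<^sub>1 W V p \<in> tangent_space A p"
        using assms(5) VF that
        by (auto simp: levi_civita_def affine_connection_def Let_def sections_on_def)
      ultimately show ?thesis by (simp add: subspace_diff subspace_tangent_space)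
    qed
    then have brackets: "g\<^sub>1 p (lie_bracket V W p) (S p) = g\<^sub>2 p (lie_bracket V W p) (S p)"
      if "V \<in> sections A \<Delta>" "W \<in> sections A \<Delta>" "S \<in> sections A \<Delta>" for V W S
      using agree that by blast
    have "2 * g\<^sub>1 p (nabla\<^sub>1 X Y p) (Z p) = 2 * g\<^sub>2 p (nabla\<^sub>2 X Y p) (Z p)"
      unfolding koszul_formula[OF g(1) assms(5) VF[OF X] VF[OF Y] VF[OF Z]]
        koszul_formula[OF g(2) assms(7) VF[OF X] VF[OF Y] VF[OF Z]]
      by (simp only: fields[OF Y Z] fields[OF X Z] fields[OF X Y]
          brackets[OF X Y Z] brackets[OF X Z Y] brackets[OF Y Z X])
    then show ?thesis by simp
  qed
  have frame: "g\<^sub>1 p (nabla\<^sub>1 X Y p) (F i p) = g\<^sub>2 p (nabla\<^sub>2 X Y p) (F i p)"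
    if p: "p \<in> U" and F: "orthonormal_frame A k \<Delta> gc U F" and i: "i < k" for p U F i
  proof -
    have U: "open U" and Fi: "F i \<in> sections_on A \<Delta> U"
      using F i by (auto simp: orthonormal_frame_def local_frame_def)
    obtain Z where Z: "Z \<in> sections A \<Delta>" "Z p = F i p"
      by (rule local_section_extends[OF A sub(1) U p Fi])
    show ?thesis using koszul[OF Z(1), of p] by (simp only: Z(2))
  qed
  have sums: "(\<Sum>i<k. g\<^sub>1 p (nabla\<^sub>1 X Y p) (F i p) *\<^sub>R F i p)
      = (\<Sum>i<k. g\<^sub>2 p (nabla\<^sub>2 X Y p) (F i p) *\<^sub>R F i p)"
    if "p \<in> U" "orthonormal_frame A k \<Delta> gc U F" for p U F
    by (rule sum.cong[OF refl]) (simp only: frame[OF that] lessThan_iff)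
  have "(p \<in> U \<and> orthonormal_frame A k \<Delta> gc U F \<and> v = (\<Sum>i<k. g\<^sub>1 p (nabla\<^sub>1 X Y p) (F i p) *\<^sub>R F i p))
    \<longleftrightarrow> (p \<in> U \<and> orthonormal_frame A k \<Delta> gc U F \<and> v = (\<Sum>i<k. g\<^sub>2 p (nabla\<^sub>2 X Y p) (F i p) *\<^sub>R F i p))"
    for p U F v
    by (intro conj_cong refl) (simp only: sums)
  then show "horizontal_connection A k \<Delta> gc g\<^sub>1 nabla\<^sub>1 X Y = horizontal_connection A k \<Delta> gc g\<^sub>2 nabla\<^sub>2 X Y"
    unfolding horizontal_connection_def by (simp only:)
qed

end
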